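(* Let $S=\{C_1,\dots,C_n\}$ be a finite set of first-order clauses. If $S$ is unsatisfiable, then there exists a refutation of contradiction separation based on standard extension of $S$, i.e. a deduction sequence of contradiction separation based on standard extension from $S$ ending in the empty clause $\emptyset$.
   Context: First-order logic. A literal is an atom or its negation; $A$ and $\neg A$ (same atom) are complementary. A clause is a finite set of literals (disjunction) with its variables implicitly universally quantified; $\emptyset$ is the empty clause; $S$ is unsatisfiable if the conjunction of the universal closures of its clauses has no model. For a substitution $\theta$, $D^\theta$ is the clause obtained by applying $\theta$ to each literal of $D$ and merging identical literals. Contradiction separation based on standard extension: let $m\ge2$, let $D_1,\dots,D_m$ be clauses (repetitions allowed, variables renamed so that no two share variables), $\theta_1,\dots,\theta_m$ substitutions, $L_1,\dots,L_{m-1}$ literals, and sub-clauses $D_i^{\theta_i-}\subseteq D_i^{\theta_i}$ with $D_1^{\theta_1-}=\{L_1\}$, $D_i^{\theta_i-}=\{L_i,\neg L_{i-1}\}\cup E^i$ for $2\le i\le m-1$, $D_m^{\theta_m-}=\{\neg L_{m-1}\}\cup E^m$, where $E^2=\emptyset$ and $E^j\subseteq\{\neg L_1,\dots,\neg L_{j-2}\}$ for $3\le j\le m$. Then $R_s(D_1^{\theta_1},\dots,D_m^{\theta_m})=\bigcup_{i=1}^m(D_i^{\theta_i}\setminus D_i^{\theta_i-})$ is a contradiction separation clause based on standard extension. A deduction sequence of contradiction separation based on standard extension from $S$ to $\phi_t$ is a sequence of clauses $\phi_1,\dots,\phi_t$ where each $\phi_i$ either lies in $S$ or there are indices $r_1,\dots,r_{k_i}<i$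 and substitutions such that $\phi_i$ is a contradiction separation clause based on standard extension of the corresponding instances of $\phi_{r_1},\dots,\phi_{r_{k_i}}$; it is a refutation if $\phi_t=\emptyset$. *)

theory Defs
  imports Main
begin

text \<open>A function or predicate symbol together with the length of its argument list plays the
  role of a symbol of that arity. Variables are natural numbers.\<close>

datatype 'f trm = Var nat | Fun 'f "'f trm list"

datatype ('f, 'p) atom = Atom 'p "'f trm list"

datatype ('f, 'p) literal = Pos "('f, 'p) atom" | Neg "('f, 'p) atom"

text \<open>Finiteness of clauses is a hypothesis on the input set; derived clauses are then finite.\<close>

type_synonym ('f, 'p) clause = "('f, 'p) literal set"

fun complement :: "('f, 'p) literal \<Rightarrow> ('f, 'p) literal" where
  "complement (Pos A) = Neg A"
| "complement (Neg A) = Pos A"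


type_synonym 'f subst = "nat \<Rightarrow> 'f trm"

primrec subst_trm :: "'f subst \<Rightarrow> 'f trm \<Rightarrow> 'f trm" where
  "subst_trm \<theta> (Var x) = \<theta> x"
| "subst_trm \<theta> (Fun f ts) = Fun f (map (subst_trm \<theta>) ts)"

primrec subst_atom :: "'f subst \<Rightarrow> ('f, 'p) atom \<Rightarrow> ('f, 'p) atom" where
  "subst_atom \<theta> (Atom p ts) = Atom p (map (subst_trm \<theta>) ts)"

primrec subst_literal :: "'f subst \<Rightarrow> ('f, 'p) literal \<Rightarrow> ('f, 'p) literal" where
  "subst_literal \<theta> (Pos A) = Pos (subst_atom \<theta> A)"
| "subst_literal \<theta> (Neg A) = Neg (subst_atom \<theta> A)"

definition subst_clause :: "'f subst \<Rightarrow> ('f, 'p) clause \<Rightarrow> ('f, 'p) clause" where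
  "subst_clause \<theta> C = subst_literal \<theta> ` C"

primrec vars_trm :: "'f trm \<Rightarrow> nat set" where
  "vars_trm (Var x) = {x}"
| "vars_trm (Fun f ts) = \<Union> (set (map vars_trm ts))"

primrec vars_atom :: "('f, 'p) atom \<Rightarrow> nat set" where
  "vars_atom (Atom p ts) = \<Union> (set (map vars_trm ts))"

primrec vars_literal :: "('f, 'p) literal \<Rightarrow> nat set" where
  "vars_literal (Pos A) = vars_atom A"
| "vars_literal (Neg A) = vars_atom A"

definition vars_clause :: "('f, 'p) clause \<Rightarrow> nat set" where
  "vars_clause C = (\<Union>L\<in>C. vars_literal L)"

definition variant_of :: "('f, 'p) clause \<Rightarrow> ('f, 'p) clause \<Rightarrow> bool" where
  "variant_of D C \<longleftrightarrow> (\<exists>\<rho>. inj_on \<rho> (vars_clause C) \<and> D = subst_clause (\<lambda>x. Var (\<rho> x)) C)"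


definition is_structure :: "'u set \<Rightarrow> ('f \<Rightarrow> 'u list \<Rightarrow> 'u) \<Rightarrow> bool" where
  "is_structure U F \<longleftrightarrow> U \<noteq> {} \<and> (\<forall>f us. set us \<subseteq> U \<longrightarrow> F f us \<in> U)"

primrec eval_trm :: "('f \<Rightarrow> 'u list \<Rightarrow> 'u) \<Rightarrow> (nat \<Rightarrow> 'u) \<Rightarrow> 'f trm \<Rightarrow> 'u" where
  "eval_trm F \<beta> (Var x) = \<beta> x"
| "eval_trm F \<beta> (Fun f ts) = F f (map (eval_trm F \<beta>) ts)"

primrec holds_atom ::
  "('f \<Rightarrow> 'u list \<Rightarrow> 'u) \<Rightarrow> ('p \<Rightarrow> 'u list \<Rightarrow> bool) \<Rightarrow> (nat \<Rightarrow> 'u) \<Rightarrow> ('f, 'p) atom \<Rightarrow> bool" where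
  "holds_atom F P \<beta> (Atom p ts) = P p (map (eval_trm F \<beta>) ts)"

primrec holds_literal ::
  "('f \<Rightarrow> 'u list \<Rightarrow> 'u) \<Rightarrow> ('p \<Rightarrow> 'u list \<Rightarrow> bool) \<Rightarrow> (nat \<Rightarrow> 'u) \<Rightarrow> ('f, 'p) literal \<Rightarrow> bool" where
  "holds_literal F P \<beta> (Pos A) = holds_atom F P \<beta> A"
| "holds_literal F P \<beta> (Neg A) = (\<not> holds_atom F P \<beta> A)"

definition is_model ::
  "'u set \<Rightarrow> ('f \<Rightarrow> 'u list \<Rightarrow> 'u) \<Rightarrow> ('p \<Rightarrow> 'u list \<Rightarrow> bool) \<Rightarrow> ('f, 'p) clause set \<Rightarrow> bool" where
  "is_model U F P S \<longleftrightarrow> is_structure U F \<and>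
     (\<forall>C\<in>S. \<forall>\<beta>. range \<beta> \<subseteq> U \<longrightarrow> (\<exists>L\<in>C. holds_literal F P \<beta> L))"

text \<open>HOL cannot quantify over all types inside a formula, so the type from which the domains
  (arbitrary nonempty subsets) are drawn is a parameter. A set of clauses without any model is in
  particular unsatisfiable over every infinite type; conversely, by Loewenheim-Skolem, a finite
  satisfiable set of finite clauses has a model inside every infinite type.\<close>

definition unsatisfiable :: "'u itself \<Rightarrow> ('f, 'p) clause set \<Rightarrow> bool" where
  "unsatisfiable (_ :: 'u itself) S \<longleftrightarrow>
     \<not> (\<exists>(U :: 'u set) F P. is_model U F P S)"


text \<open>\<open>R\<close> is the clause $R_s(D_1^{\theta_1},\dots,D_m^{\theta_m})$ for some choice of separated
  sub-clauses \<open>Dm i\<close> $= D_i^{\theta_i-}$; all families are indexed from 1, and their values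
  outside the stated ranges are irrelevant.\<close>

definition contradiction_separation ::
  "nat \<Rightarrow> (nat \<Rightarrow> ('f, 'p) clause) \<Rightarrow> (nat \<Rightarrow> 'f subst) \<Rightarrow> ('f, 'p) clause \<Rightarrow> bool" where
  "contradiction_separation m D \<theta> R \<longleftrightarrow>
     2 \<le> m \<and>
     (\<forall>i\<in>{1..m}. \<forall>j\<in>{1..m}. i \<noteq> j \<longrightarrow> vars_clause (D i) \<inter> vars_clause (D j) = {}) \<and>
     (\<exists>(L :: nat \<Rightarrow> ('f, 'p) literal) (Dm :: nat \<Rightarrow> ('f, 'p) clause) (E :: nat \<Rightarrow> ('f, 'p) clause).
        (\<forall>i\<in>{1..m}. Dm i \<subseteq> subst_clause (\<theta> i) (D i)) \<and>
        Dm 1 = {L 1} \<and>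
        (\<forall>i\<in>{2..m-1}. Dm i = {L i, complement (L (i - 1))} \<union> E i) \<and>
        Dm m = {complement (L (m - 1))} \<union> E m \<and>
        E 2 = {} \<and>
        (\<forall>j\<in>{3..m}. E j \<subseteq> {complement (L k) | k. k \<in> {1..j-2}}) \<and>
        R = (\<Union>i\<in>{1..m}. subst_clause (\<theta> i) (D i) - Dm i))"

text \<open>The premises of a step are variable-disjoint variants of earlier clauses of the sequence,
  where the same earlier clause may be used several times.\<close>

definition is_deduction :: "('f, 'p) clause set \<Rightarrow> ('f, 'p) clause list \<Rightarrow> bool" where
  "is_deduction S \<phi> \<longleftrightarrow> \<phi> \<noteq> [] \<and>
     (\<forall>i < length \<phi>. \<phi> ! i \<in> S \<or>
        (\<exists>m r D \<theta>. (\<forall>k\<in>{1..m}. r k < i \<and> variant_of (D k) (\<phi> ! (r k))) \<and>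
                   contradiction_separation m D \<theta> (\<phi> ! i)))"

definition is_refutation :: "('f, 'p) clause set \<Rightarrow> ('f, 'p) clause list \<Rightarrow> bool" where
  "is_refutation S \<phi> \<longleftrightarrow> is_deduction S \<phi> \<and> last \<phi> = {}"

end

(* The two-premise case of a contradiction separation step, taken with arbitrary instantiating
   substitutions, is resolution on arbitrary instances of the premises. Hence propositional
   resolution among the instances of S can be replayed step by step without unifiers, and
   propositional resolution is complete even for infinite sets of finite clauses. The Herbrand
   model that would exist if no refutation did is countable, since finitely many function symbols
   occur in S, so it can be copied into any infinite type. *)

theory Submission
  imports Defs "HOL-Library.Countable_Set"
begin

lemma complement_complement [simp]: "complement (complement L) = L"
  by (cases L) auto

lemma complement_neq [simp]: "complement L \<noteq> L" "L \<noteq> complement L"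
  by (cases L; simp)+

subsection \<open>Propositional resolution\<close>

text \<open>Literals are compared syntactically, without unification, so any variables in them
  behave like constants.\<close>

inductive_set resolvents :: "('f, 'p) clause set \<Rightarrow> ('f, 'p) clause set"
  for G :: "('f, 'p) clause set" where
  base: "C \<in> G \<Longrightarrow> C \<in> resolvents G"
| resolve: "\<lbrakk>C1 \<in> resolvents G; C2 \<in> resolvents G; L \<in> C1; complement L \<in> C2\<rbrakk>
    \<Longrightarrow> (C1 - {L}) \<union> (C2 - {complement L}) \<in> resolvents G"

lemma resolvents_mono:
  assumes "G \<subseteq> H"
  shows "resolvents G \<subseteq> resolvents H"
proof
  show "C \<in> resolvents H" if "C \<in> resolvents G" for C
    using that assms by induction (auto intro: resolvents.intros)
qed

text \<open>Each resolution step has only two premises, and the larger of two members of a chain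
  derives both. This gives the upper bounds for Zorn's lemma.\<close>

lemma resolvents_Union_chain:
  assumes "subset.chain A \<C>" and "C \<in> resolvents (\<Union>\<C>)"
  shows "\<exists>M\<in>\<C>. C \<in> resolvents M"
  using assms(2)
proof induction
  case (base C)
  then show ?case by (auto intro: resolvents.base)
next
  case (resolve C1 C2 L)
  then obtain M N where MN: "M \<in> \<C>" "C1 \<in> resolvents M" "N \<in> \<C>" "C2 \<in> resolvents N"
    by blast
  then have "M \<subseteq> N \<or> N \<subseteq> M"
    using assms(1) by (auto simp: subset_chain_def)
  then obtain K where "K \<in> \<C>" "C1 \<in> resolvents K" "C2 \<in> resolvents K"
    using MN resolvents_mono by blast
  then show ?case
    using resolvents.resolve resolve.hyps by blast
qed

text \<open>Resolving with \<open>{L}\<close> only deletes \<open>complement L\<close>, so leaving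
  such steps out adds at most that literal. The disjunct \<open>L \<in> C\<close> covers the unit
  itself.\<close>

lemma resolvents_insert_unit:
  assumes "C \<in> resolvents (insert {L} M)"
  shows "L \<in> C \<or> (\<exists>C'\<in>resolvents M. C' - {complement L} \<subseteq> C)"
  using assms
proof induction
  case (base C)
  then show ?case by (auto intro: resolvents.base)
next
  case (resolve C1 C2 K)
  show ?case
  \<comment> \<open>A step on \<open>L\<close> costs one premise only the literal
    \<open>complement L\<close>, so the counterpart of that premise still works.\<close>
  proof (cases "K = L \<or> complement K = L")
    case True
    then show ?thesis
    proof
      assume "K = L"
      then show ?thesis using resolve.IH(2) by auto
    next
      assume "complement K = L"
      then have "K = complement L" by auto
      then show ?thesis using resolve.IH(1) by auto
    qed
  next
    case False
    show ?thesis
    proof (cases "L \<in> C1 \<or> L \<in> C2")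
      case True
      with False show ?thesis by auto
    next
      case outside: False
      then obtain D1 D2 where
        D1: "D1 \<in> resolvents M" "D1 - {complement L} \<subseteq> C1" and
        D2: "D2 \<in> resolvents M" "D2 - {complement L} \<subseteq> C2"
        using resolve.IH by blast
      show ?thesis
      proof (cases "K \<in> D1 \<and> complement K \<in> D2")
        case True
        then have "(D1 - {K}) \<union> (D2 - {complement K}) \<in> resolvents M"
          using D1 D2 resolvents.resolve by blast
        moreover have "(D1 - {K}) \<union> (D2 - {complement K}) - {complement L}
            \<subseteq> (C1 - {K}) \<union> (C2 - {complement K})"
          using D1 D2 by blast
        ultimately show ?thesis by blast
      next
        \<comment> \<open>If a counterpart lacks the literal resolved upon, it already lies in the
          resolvent up to \<open>complement L\<close>; no step is made.\<close>
        case False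
        then have "D1 - {complement L} \<subseteq> C1 - {K} \<or> D2 - {complement L} \<subseteq> C2 - {complement K}"
          using D1 D2 by blast
        then show ?thesis
        proof
          assume "D1 - {complement L} \<subseteq> C1 - {K}"
          then show ?thesis using D1(1) by (intro disjI2 bexI[of _ D1]) auto
        next
          assume "D2 - {complement L} \<subseteq> C2 - {complement K}"
          then show ?thesis using D2(1) by (intro disjI2 bexI[of _ D2]) auto
        qed
      qed
    qed
  qed
qed

lemma empty_resolvent_insert_unit:
  assumes "{} \<in> resolvents (insert {L} M)" and "{} \<notin> resolvents M"
  shows "{complement L} \<in> resolvents M"
proof -
  obtain C where "C \<in> resolvents M" "C \<subseteq> {complement L}"
    using resolvents_insert_unit[OF assms(1)] by auto
  with assms(2) show ?thesis by (auto simp: subset_singleton_iff)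
qed

text \<open>The literals of \<open>C\<close> are resolved away one at a time, which is where
  finiteness of a clause enters.\<close>

lemma empty_resolvent_of_units:
  assumes "finite C" and "C \<in> resolvents M" and "\<forall>L\<in>C. {complement L} \<in> resolvents M"
  shows "{} \<in> resolvents M"
  using assms
proof (induction C)
  case (insert L C)
  have "(insert L C - {L}) \<union> ({complement L} - {complement L}) \<in> resolvents M"
    using insert.prems by (intro resolvents.resolve) auto
  then have "C \<in> resolvents M" using insert.hyps by simp
  with insert show ?case by simp
qed

text \<open>Zorn's lemma extends \<open>G\<close> to a maximal \<open>M\<close> that does not derive
  \<open>{}\<close>; the units derivable from \<open>M\<close> form the valuation \<open>T\<close>.
  No compactness argument is required for infinite \<open>G\<close>.\<close>

theorem resolution_complete:
  fixes G :: "('f, 'p) clause set"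
  assumes fin: "\<forall>C\<in>G. finite C" and noempty: "{} \<notin> resolvents G"
  obtains T where "\<And>L. complement L \<in> T \<longleftrightarrow> L \<notin> T" and "\<And>C. C \<in> G \<Longrightarrow> \<exists>L\<in>C. L \<in> T"
proof -
  define A where "A = {M. G \<subseteq> M \<and> {} \<notin> resolvents M}"
  have "A \<noteq> {}" using noempty by (auto simp: A_def)
  moreover have "\<Union>\<C> \<in> A" if "\<C> \<noteq> {}" "subset.chain A \<C>" for \<C>
  proof -
    have "\<C> \<subseteq> A" using that(2) by (auto simp: subset_chain_def)
    then show ?thesis
      using that(1) resolvents_Union_chain[OF that(2)] by (fastforce simp: A_def)
  qed
  ultimately obtain M where M: "M \<in> A" and max: "\<forall>X\<in>A. M \<subseteq> X \<longrightarrow> X = M"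
    using subset_Zorn_nonempty[of A] by blast
  have sub: "G \<subseteq> M" and ne: "{} \<notin> resolvents M" using M by (auto simp: A_def)
  define T where "T = {L. {L} \<in> resolvents M}"
  \<comment> \<open>Either \<open>{L}\<close> can be added to \<open>M\<close>, and then maximality
    puts it there, or adding it derives \<open>{}\<close>, and then \<open>M\<close> derives the
    opposite unit.\<close>
  have total: "L \<in> T \<or> complement L \<in> T" for L
  proof (cases "{} \<in> resolvents (insert {L} M)")
    case True
    then show ?thesis using empty_resolvent_insert_unit ne by (auto simp: T_def)
  next
    case False
    then have "insert {L} M \<in> A" using sub by (auto simp: A_def)
    then have "{L} \<in> M" using max by blast
    then show ?thesis by (auto simp: T_def intro: resolvents.base)
  qed
  have consistent: "\<not> (L \<in> T \<and> complement L \<in> T)" for L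
    using resolvents.resolve[of "{L}" M "{complement L}" L] ne by (auto simp: T_def)
  have "\<exists>L\<in>C. L \<in> T" if C: "C \<in> G" for C
  proof (rule ccontr)
    assume "\<not> ?thesis"
    then have "\<forall>L\<in>C. {complement L} \<in> resolvents M" using total by (auto simp: T_def)
    then show False
      using empty_resolvent_of_units[of C M] C sub fin ne by (auto intro: resolvents.base)
  qed
  then show thesis using that total consistent by blast
qed

subsection \<open>Replaying resolution between instances\<close>

lemma subst_trm_rename:
  "subst_trm \<theta> (subst_trm (\<lambda>x. Var (\<rho> x)) t) = subst_trm (\<lambda>x. \<theta> (\<rho> x)) t"
  by (induction t) auto

lemma subst_literal_rename:
  "subst_literal \<theta> (subst_literal (\<lambda>x. Var (\<rho> x)) L) = subst_literal (\<lambda>x. \<theta> (\<rho> x)) L"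
proof -
  have "subst_atom \<theta> (subst_atom (\<lambda>x. Var (\<rho> x)) A) = subst_atom (\<lambda>x. \<theta> (\<rho> x)) A" for A :: "('a, 'b) atom"
    by (cases A) (auto simp: subst_trm_rename)
  then show ?thesis by (cases L) auto
qed

lemma subst_clause_rename:
  "subst_clause \<theta> (subst_clause (\<lambda>x. Var (\<rho> x)) C) = subst_clause (\<lambda>x. \<theta> (\<rho> x)) C"
  by (auto simp: subst_clause_def subst_literal_rename image_image)

lemma subst_trm_Var [simp]: "subst_trm Var t = t"
  by (induction t) (auto simp: map_idI)

lemma subst_literal_Var [simp]: "subst_literal Var L = L"
proof -
  have "subst_atom Var A = A" for A :: "('a, 'b) atom"
    by (cases A) (auto simp: map_idI)
  then show ?thesis by (cases L) auto
qed

lemma subst_clause_Var [simp]: "subst_clause Var C = C"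
  by (simp add: subst_clause_def)

lemma vars_trm_rename: "vars_trm (subst_trm (\<lambda>x. Var (\<rho> x)) t) = \<rho> ` vars_trm t"
  by (induction t) auto

lemma vars_clause_rename_subset: "vars_clause (subst_clause (\<lambda>x. Var (\<rho> x)) C) \<subseteq> range \<rho>"
proof -
  have atom: "vars_atom (subst_atom (\<lambda>x. Var (\<rho> x)) A) \<subseteq> range \<rho>" for A :: "('a, 'b) atom"
    by (cases A) (auto simp: vars_trm_rename)
  have "vars_literal (subst_literal (\<lambda>x. Var (\<rho> x)) L) \<subseteq> range \<rho>" for L :: "('a, 'b) literal"
    using atom by (cases L) auto
  then show ?thesis by (auto simp: vars_clause_def subst_clause_def)
qed

text \<open>For \<open>m = 2\<close> the middle index range is empty and \<open>E 2 = {}\<close>, so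
  the separated parts are just the two complementary units; only \<open>L 1\<close> is ever
  read.\<close>

lemma contradiction_separation_binary:
  assumes "L \<in> subst_clause (\<theta> 1) (D 1)" and "complement L \<in> subst_clause (\<theta> 2) (D 2)"
    and "vars_clause (D 1) \<inter> vars_clause (D 2) = {}"
  shows "contradiction_separation 2 D \<theta>
    ((subst_clause (\<theta> 1) (D 1) - {L}) \<union> (subst_clause (\<theta> 2) (D 2) - {complement L}))"
proof -
  have 12: "{1..2} = {1, 2::nat}" by auto
  show ?thesis
    unfolding contradiction_separation_def 12
    using assms
    by (intro conjI exI[of _ "\<lambda>_. L"] exI[of _ "\<lambda>i. if i = 1 then {L} else {complement L}"]
        exI[of _ "\<lambda>_. {}"]) auto
qed

text \<open>The premises may share variables or even coincide: they are renamed apart, and the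
  step's own substitutions undo the renaming before applying \<open>\<sigma>1\<close> and
  \<open>\<sigma>2\<close>.\<close>

lemma resolve_instances:
  fixes \<sigma>1 \<sigma>2 :: "'f subst"
  assumes "L \<in> subst_clause \<sigma>1 C1" and "complement L \<in> subst_clause \<sigma>2 C2"
  obtains D \<theta> where "variant_of (D 1) C1" and "variant_of (D 2) C2"
    and "contradiction_separation 2 D \<theta>
      ((subst_clause \<sigma>1 C1 - {L}) \<union> (subst_clause \<sigma>2 C2 - {complement L}))"
proof -
  \<comment> \<open>Even and odd variables keep the two premises apart.\<close>
  define D where "D i = (if i = (1::nat) then subst_clause (\<lambda>x. Var (2 * x)) C1
      else subst_clause (\<lambda>x. Var (2 * x + 1)) C2)" for i
  \<comment> \<open>\<open>div 2\<close> inverts both \<open>2 * x\<close> and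
    \<open>2 * x + 1\<close>.\<close>
  define \<theta> where "\<theta> i = (if i = (1::nat) then (\<lambda>x. \<sigma>1 (x div 2)) else (\<lambda>x. \<sigma>2 (x div 2)))" for i
  have inst: "subst_clause (\<theta> 1) (D 1) = subst_clause \<sigma>1 C1"
    "subst_clause (\<theta> 2) (D 2) = subst_clause \<sigma>2 C2"
    by (simp_all add: D_def \<theta>_def subst_clause_rename del: One_nat_def)
  have "vars_clause (D 1) \<subseteq> range (\<lambda>x. 2 * x)"
    unfolding D_def using vars_clause_rename_subset[of "\<lambda>x. 2 * x" C1] by simp
  moreover have "vars_clause (D 2) \<subseteq> range (\<lambda>x. 2 * x + 1)"
    unfolding D_def using vars_clause_rename_subset[of "\<lambda>x. 2 * x + 1" C2] by simp
  moreover have "range (\<lambda>x::nat. 2 * x) \<inter> range (\<lambda>x. 2 * x + 1) = {}"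
    by (auto, presburger)
  ultimately have "vars_clause (D 1) \<inter> vars_clause (D 2) = {}" by blast
  then have "contradiction_separation 2 D \<theta>
      ((subst_clause \<sigma>1 C1 - {L}) \<union> (subst_clause \<sigma>2 C2 - {complement L}))"
    using contradiction_separation_binary[of L \<theta> D] assms inst by simp
  moreover have "variant_of (D 1) C1"
    unfolding variant_of_def D_def by (intro exI[of _ "\<lambda>x. 2 * x"]) (auto simp: inj_on_def)
  moreover have "variant_of (D 2) C2"
    unfolding variant_of_def D_def by (intro exI[of _ "\<lambda>x. 2 * x + 1"]) (auto simp: inj_on_def)
  ultimately show thesis using that by blast
qed

section \<open>Building deduction sequences\<close>

text \<open>Premises come from a set instead of through indices, so that lengthening a sequence
  becomes monotonicity in \<open>X\<close>.\<close>

definition derivable_from ::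
  "('f, 'p) clause set \<Rightarrow> ('f, 'p) clause set \<Rightarrow> ('f, 'p) clause \<Rightarrow> bool" where
  "derivable_from S X R \<longleftrightarrow> R \<in> S \<or>
     (\<exists>m D \<theta>. (\<forall>k\<in>{1..m}. \<exists>C\<in>X. variant_of (D k) C) \<and> contradiction_separation m D \<theta> R)"

lemma derivable_from_mono: "derivable_from S X R \<Longrightarrow> X \<subseteq> Y \<Longrightarrow> derivable_from S Y R"
  unfolding derivable_from_def by (meson subsetD)

lemma derivable_from_take_iff:
  assumes "i \<le> length \<phi>"
  shows "derivable_from S (set (take i \<phi>)) R \<longleftrightarrow> R \<in> S \<or>
    (\<exists>m r D \<theta>. (\<forall>k\<in>{1..m}. r k < i \<and> variant_of (D k) (\<phi> ! r k)) \<and>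
      contradiction_separation m D \<theta> R)"
proof -
  have "(\<forall>k\<in>{1..m}. \<exists>C\<in>set (take i \<phi>). variant_of (D k) C) \<longleftrightarrow>
      (\<exists>r. \<forall>k\<in>{1..m}. r k < i \<and> variant_of (D k) (\<phi> ! r k))" for m and D :: "nat \<Rightarrow> _"
    \<comment> \<open>Choice turns one premise per \<open>k\<close> into the index function
      \<open>r\<close>.\<close>
    unfolding nth_image[OF assms, symmetric] by (simp add: Bex_def bchoice_iff)
  then show ?thesis unfolding derivable_from_def by (simp only:) blast
qed

lemma is_deduction_iff:
  "is_deduction S \<phi> \<longleftrightarrow> \<phi> \<noteq> [] \<and> (\<forall>i<length \<phi>. derivable_from S (set (take i \<phi>)) (\<phi> ! i))"
  by (simp add: is_deduction_def derivable_from_take_iff)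

text \<open>The steps of \<open>\<psi>\<close> keep all their premises when \<open>\<phi>\<close> is
  put in front.\<close>

lemma is_deduction_append:
  assumes "is_deduction S \<phi>" and "is_deduction S \<psi>"
  shows "is_deduction S (\<phi> @ \<psi>)"
proof -
  have "derivable_from S (set \<phi> \<union> set (take (i - length \<phi>) \<psi>)) (\<psi> ! (i - length \<phi>))"
    if "\<not> i < length \<phi>" "i < length \<phi> + length \<psi>" for i
  proof (rule derivable_from_mono[OF _ Un_upper2])
    have "i - length \<phi> < length \<psi>" using that by linarith
    then show "derivable_from S (set (take (i - length \<phi>) \<psi>)) (\<psi> ! (i - length \<phi>))"
      using assms(2) by (simp add: is_deduction_iff)
  qed
  then show ?thesis
    using assms by (auto simp: is_deduction_iff nth_append)
qed

lemma is_deduction_snoc: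
  assumes "is_deduction S \<phi>" and "derivable_from S (set \<phi>) R"
  shows "is_deduction S (\<phi> @ [R])"
  using assms unfolding is_deduction_iff
  by (auto simp: nth_append less_Suc_eq)

lemma is_deduction_singleton: "C \<in> S \<Longrightarrow> is_deduction S [C]"
  by (simp add: is_deduction_def)

text \<open>An instance of an input clause belongs to a one-element deduction. A resolution step
  absorbs the instantiations of both premises, so its result is derived exactly and
  \<open>\<sigma>\<close> is \<open>Var\<close>.\<close>

lemma deduction_of_resolvent:
  assumes "R \<in> resolvents {subst_clause \<sigma> C | \<sigma> C. C \<in> S \<and> P \<sigma>}"
  shows "\<exists>\<phi> \<sigma>. is_deduction S \<phi> \<and> R = subst_clause \<sigma> (last \<phi>)"
  using assms
proof induction
  case (base R)
  then obtain \<sigma> C where "R = subst_clause \<sigma> C" "C \<in> S" by blast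
  then show ?case using is_deduction_singleton[of C S] by (metis last.simps)
next
  case (resolve R1 R2 L)
  then obtain \<phi> \<sigma>1 \<psi> \<sigma>2 where
    \<phi>: "is_deduction S \<phi>" "R1 = subst_clause \<sigma>1 (last \<phi>)" and
    \<psi>: "is_deduction S \<psi>" "R2 = subst_clause \<sigma>2 (last \<psi>)"
    by blast
  let ?R = "(R1 - {L}) \<union> (R2 - {complement L})"
  obtain D \<theta> where D: "variant_of (D 1) (last \<phi>)" "variant_of (D 2) (last \<psi>)"
    and sep: "contradiction_separation 2 D \<theta> ?R"
    using resolve_instances[of L \<sigma>1 "last \<phi>" \<sigma>2 "last \<psi>"] resolve.hyps \<phi> \<psi> by blast
  have "last \<phi> \<in> set (\<phi> @ \<psi>)" "last \<psi> \<in> set (\<phi> @ \<psi>)"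
    using \<phi> \<psi> by (auto simp: is_deduction_def)
  moreover have 12: "{1..2} = {1, 2::nat}" by auto
  ultimately have "\<forall>k\<in>{1..2}. \<exists>C\<in>set (\<phi> @ \<psi>). variant_of (D k) C"
    unfolding 12 using D by blast
  with sep have "derivable_from S (set (\<phi> @ \<psi>)) ?R"
    unfolding derivable_from_def by blast
  then have "is_deduction S ((\<phi> @ \<psi>) @ [?R])"
    using is_deduction_snoc is_deduction_append \<phi> \<psi> by blast
  then show ?case by (intro exI[of _ "(\<phi> @ \<psi>) @ [?R]"] exI[of _ Var]) simp
qed

subsection \<open>A countable Herbrand model\<close>

instance trm :: (countable) countable
  by countable_datatype

text \<open>The type \<open>'f\<close> may be uncountable, but numbering the symbols of
  \<open>\<Sigma>\<close> embeds these terms into the countable type \<open>nat trm\<close>.\<close>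

lemma countable_trm:
  assumes "countable \<Sigma>"
  shows "countable {t. set_trm t \<subseteq> \<Sigma>}"
proof -
  have "inj_on (map_trm (to_nat_on \<Sigma>)) {t. set_trm t \<subseteq> \<Sigma>}"
    using assms inj_on_to_nat_on[OF assms]
    by (intro inj_onI) (rule trm.inj_map_strong, auto simp: inj_on_def subset_iff)
  then show ?thesis by (rule countableI')
qed

lemma finite_set_trm: "finite (set_trm t)"
  by (induction t) auto

lemma finite_set1_literal: "finite (set1_literal L)"
proof -
  have "finite (set1_atom A)" for A :: "('a, 'b) atom"
    by (cases A) (auto simp: finite_set_trm)
  then show ?thesis by (cases L) auto
qed

lemma set_subst_trm_subset:
  assumes "set_trm t \<subseteq> \<Sigma>" and "\<forall>x. set_trm (\<sigma> x) \<subseteq> \<Sigma>"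
  shows "set_trm (subst_trm \<sigma> t) \<subseteq> \<Sigma>"
  using assms by (induction t) (simp_all add: SUP_le_iff)

text \<open>This is the term model over \<open>\<Sigma>\<close> with truth read off
  \<open>T\<close>, carried into \<open>'u\<close> along \<open>g\<close>. Its terms may contain
  variables, so the domain is nonempty even if \<open>\<Sigma>\<close> has no constants.\<close>

theorem herbrand_model:
  fixes S :: "('f, 'p) clause set" and g :: "'f trm \<Rightarrow> 'u"
  assumes inj: "inj_on g {t. set_trm t \<subseteq> \<Sigma>}"
    and sig: "\<And>C L. C \<in> S \<Longrightarrow> L \<in> C \<Longrightarrow> set1_literal L \<subseteq> \<Sigma>"
    and compl: "\<And>L. complement L \<in> T \<longleftrightarrow> L \<notin> T"
    and sat: "\<And>C \<sigma>. C \<in> S \<Longrightarrow> \<forall>x. set_trm (\<sigma> x) \<subseteq> \<Sigma> \<Longrightarrow> \<exists>L\<in>subst_clause \<sigma> C. L \<in> T"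
  shows "\<exists>(U :: 'u set) F P. is_model U F P S"
proof -
  define H where "H = {t :: 'f trm. set_trm t \<subseteq> \<Sigma>}"
  define U where "U = g ` H"
  define h where "h = inv_into H g"
  \<comment> \<open>Symbols outside \<open>\<Sigma>\<close> do not occur in \<open>S\<close>; the
    default value keeps \<open>U\<close> closed under \<open>F\<close>.\<close>
  define F where "F f us = (if f \<in> \<Sigma> then g (Fun f (map h us)) else g (Var 0))" for f us
  define P where "P p us \<longleftrightarrow> Pos (Atom p (map h us)) \<in> T" for p us
  have hg: "h (g t) = t" if "t \<in> H" for t
    using inj that by (simp add: h_def H_def)
  have hU: "h u \<in> H" if "u \<in> U" for u
    using that by (simp add: h_def U_def inv_into_into)
  have gh: "g (h u) = u" if "u \<in> U" for u
    using that by (simp add: h_def U_def f_inv_into_f)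
  have "F f us \<in> U" if "set us \<subseteq> U" for f us
  proof (cases "f \<in> \<Sigma>")
    case True
    then have "Fun f (map h us) \<in> H" using that hU by (fastforce simp: H_def)
    then show ?thesis using True by (simp add: F_def U_def)
  next
    case False
    have "Var 0 \<in> H" by (simp add: H_def)
    then show ?thesis using False by (simp add: F_def U_def)
  qed
  moreover have "U \<noteq> {}"
  proof -
    have "Var 0 \<in> H" by (simp add: H_def)
    then show ?thesis by (auto simp: U_def)
  qed
  ultimately have struct: "is_structure U F" by (auto simp: is_structure_def)
  have "\<exists>L\<in>C. holds_literal F P \<beta> L" if C: "C \<in> S" and \<beta>: "range \<beta> \<subseteq> U" for C \<beta>
  proof -
    \<comment> \<open>Since domain elements encode terms, an assignment is a substitution, and
      evaluation becomes instantiation.\<close>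
    define \<sigma> where "\<sigma> x = h (\<beta> x)" for x
    have \<sigma>: "set_trm (\<sigma> x) \<subseteq> \<Sigma>" for x
      using hU \<beta> by (auto simp: \<sigma>_def H_def)
    have subst_H: "subst_trm \<sigma> t \<in> H" if "set_trm t \<subseteq> \<Sigma>" for t
      using set_subst_trm_subset[OF that, of \<sigma>] \<sigma> by (simp add: H_def)
    have eval: "eval_trm F \<beta> t = g (subst_trm \<sigma> t)" if "set_trm t \<subseteq> \<Sigma>" for t
      using that
    proof (induction t)
      case (Var x)
      then show ?case using gh \<beta> by (simp add: \<sigma>_def range_subsetD)
    next
      case (Fun f ts)
      then have "map h (map (eval_trm F \<beta>) ts) = map (subst_trm \<sigma>) ts"
        using hg subst_H by (simp add: SUP_le_iff)
      moreover have "f \<in> \<Sigma>" using Fun.prems by simp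
      ultimately show ?case by (simp add: F_def[of f] del: map_map)
    qed
    have atom: "holds_atom F P \<beta> A \<longleftrightarrow> Pos (subst_atom \<sigma> A) \<in> T" if A: "set1_atom A \<subseteq> \<Sigma>" for A
    proof (cases A)
      case (Atom p ts)
      then have "map h (map (eval_trm F \<beta>) ts) = map (subst_trm \<sigma>) ts"
        using A eval hg subst_H by (simp add: SUP_le_iff)
      then show ?thesis by (simp add: Atom P_def del: map_map)
    qed
    have lit: "holds_literal F P \<beta> L \<longleftrightarrow> subst_literal \<sigma> L \<in> T" if "set1_literal L \<subseteq> \<Sigma>" for L
      using that atom compl[of "Pos _"] by (cases L) auto
    obtain L where "L \<in> C" "subst_literal \<sigma> L \<in> T"
      using sat[OF C, of \<sigma>] \<sigma> by (auto simp: subst_clause_def)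
    then show ?thesis using lit sig C by blast
  qed
  with struct have "is_model U F P S" by (simp add: is_model_def)
  then show ?thesis by blast
qed

section \<open>From the absence of a refutation to a model\<close>

theorem theorem5p4:
  fixes S :: "('f, 'p) clause set"
  assumes "finite S"
    and "\<forall>C\<in>S. finite C"
    and "infinite (UNIV :: 'u set)"
    and "unsatisfiable TYPE('u) S"
  shows "\<exists>\<phi>. is_refutation S \<phi>"
proof (rule ccontr)
  assume noref: "\<not> ?thesis"
  \<comment> \<open>\<open>set1_literal\<close> collects the function symbols of a literal.\<close>
  define \<Sigma> where "\<Sigma> = (\<Union>C\<in>S. \<Union>L\<in>C. set1_literal L)"
  define G where "G = {subst_clause \<sigma> C | \<sigma> C. C \<in> S \<and> (\<forall>x. set_trm (\<sigma> x) \<subseteq> \<Sigma>)}"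
  have "{} \<notin> resolvents G"
  proof
    assume "{} \<in> resolvents G"
    then obtain \<phi> \<sigma> where "is_deduction S \<phi>" "{} = subst_clause \<sigma> (last \<phi>)"
      using deduction_of_resolvent[of "{}" S "\<lambda>\<sigma>. \<forall>x. set_trm (\<sigma> x) \<subseteq> \<Sigma>"]
      unfolding G_def by blast
    \<comment> \<open>Only the empty clause has an empty instance.\<close>
    then have "is_refutation S \<phi>" by (simp add: is_refutation_def subst_clause_def)
    then show False using noref by blast
  qed
  moreover have "\<forall>C\<in>G. finite C"
    using assms(2) by (auto simp: G_def subst_clause_def)
  ultimately obtain T where T: "\<And>L. complement L \<in> T \<longleftrightarrow> L \<notin> T"
    "\<And>C. C \<in> G \<Longrightarrow> \<exists>L\<in>C. L \<in> T"
    using resolution_complete[of G] by blast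
  have "countable \<Sigma>"
    using assms(1,2) by (auto simp: \<Sigma>_def finite_set1_literal intro!: countable_finite)
  then obtain e :: "'f trm \<Rightarrow> nat" where e: "inj_on e {t. set_trm t \<subseteq> \<Sigma>}"
    using countable_trm by (auto simp: countable_def)
  \<comment> \<open>Numbering the terms by \<open>e\<close> and then applying \<open>c\<close>
    places the Herbrand universe inside the given infinite type.\<close>
  obtain c :: "nat \<Rightarrow> 'u" where "inj c"
    using infinite_countable_subset[OF assms(3)] by blast
  then have "inj_on (c \<circ> e) {t. set_trm t \<subseteq> \<Sigma>}"
    using e by (meson comp_inj_on inj_on_subset subset_UNIV)
  moreover have "\<exists>L\<in>subst_clause \<sigma> C. L \<in> T"
    if "C \<in> S" "\<forall>x. set_trm (\<sigma> x) \<subseteq> \<Sigma>" for C \<sigma>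
    using that T(2) unfolding G_def by blast
  moreover have "set1_literal L \<subseteq> \<Sigma>" if "C \<in> S" "L \<in> C" for C L
    using that by (auto simp: \<Sigma>_def)
  ultimately have "\<exists>(U :: 'u set) F P. is_model U F P S"
    using T(1) by (intro herbrand_model)
  then show False using assms(4) by (simp add: unsatisfiable_def)
qed

end
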